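(* Let $M$ be a subset of $\mathcal P_2(\mathbb{R})$. Then: (i) $M$ is bounded from above in $\mathcal P_2(\mathbb{R})$ with respect to the stochastic order if and only if $$\int_0^\infty\Big(\sup_{\mu\in M}\mu\big((u,\infty)\big)\Big)u\,\mathrm du<\infty.$$ (ii) $M$ is bounded from below in $\mathcal P_2(\mathbb{R})$ with respect to the stochastic order if and only if $$\int_0^\infty\Big(\sup_{\mu\in M}\mu\big((-\infty,-u]\big)\Big)u\,\mathrm du<\infty.$$
   Context: $\mathcal P_2(\mathbb{R})$ is the set of Borel probability measures on $\mathbb{R}$ with finite second moment. Stochastic order: $\mu\le_{\mathrm{st}}\nu$ iff $\int f\,\mathrm d\mu\le\int f\,\mathrm d\nu$ for all bounded increasing (non-decreasing) $f:\mathbb{R}\to\mathbb{R}$. $M$ is bounded from above (below) in $\mathcal P_2(\mathbb{R})$ if there is $\rho\in\mathcal P_2(\mathbb{R})$ with $\mu\le_{\mathrm{st}}\rho$ (resp. $\rho\le_{\mathrm{st}}\mu$) for all $\mu\in M$. *)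

theory Defs
  imports "HOL-Probability.Probability"
begin

definition P2 :: "real measure set" where
  "P2 = {\<mu>. prob_space \<mu> \<and> sets \<mu> = sets borel \<and> integrable \<mu> (\<lambda>x. x\<^sup>2)}"

text \<open>A non-decreasing function on the reals is Borel, so for probability measures on the
  Borel sets every bounded non-decreasing \<open>f\<close> is integrable and the Bochner integrals below
  are genuine ones.\<close>

definition st_le :: "real measure \<Rightarrow> real measure \<Rightarrow> bool" (infix "\<le>st" 50) where
  "\<mu> \<le>st \<nu> \<longleftrightarrow>
     (\<forall>f :: real \<Rightarrow> real. mono f \<longrightarrow> bounded (range f) \<longrightarrow> (\<integral>x. f x \<partial>\<mu>) \<le> (\<integral>x. f x \<partial>\<nu>))"

definition st_bdd_above :: "real measure set \<Rightarrow> bool" where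
  "st_bdd_above M \<longleftrightarrow> (\<exists>\<rho>\<in>P2. \<forall>\<mu>\<in>M. \<mu> \<le>st \<rho>)"

definition st_bdd_below :: "real measure set \<Rightarrow> bool" where
  "st_bdd_below M \<longleftrightarrow> (\<exists>\<rho>\<in>P2. \<forall>\<mu>\<in>M. \<rho> \<le>st \<mu>)"

end

theory Submission
  imports Defs
begin

text \<open>By Fubini, the integral of \<open>u\<close> times the upper tail of \<open>\<rho>\<close> over \<open>u \<ge> 0\<close> is half the second
  moment of the positive part of \<open>\<rho>\<close>, so an upper bound \<open>\<rho>\<close> in \<open>P2\<close> controls the integrated
  supremum of the tails. Conversely, a supremum of upper tails is decreasing and right-continuous;
  if its integral against \<open>u\<close> is finite, it tends to \<open>0\<close>, and replacing it by \<open>1\<close> on the negative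
  half-line gives the tail function of a law in \<open>P2\<close>, which dominates every member of \<open>M\<close>.
  Reflection at the origin reduces (ii) to (i) but turns the half-lines \<open>{..- u}\<close> into the closed
  \<open>{u..}\<close>. Therefore necessity is shown for closed tails and sufficiency for open ones.\<close>

section \<open>Tail integrals through Tonelli's theorem\<close>

text \<open>Once the measure of each section is written as the integral of an indicator, this is
  Tonelli for \<open>lborel\<close> and \<open>\<rho>\<close>. The weight \<open>w\<close> lets one
  statement serve the tail integrals (weight \<open>ennreal u\<close>) and the layer-cake formula
  (weight 1).\<close>

lemma nn_integral_emeasure_sections:
  fixes \<rho> :: "real measure" and w :: "real \<Rightarrow> ennreal"
  assumes "prob_space \<rho>" and [measurable_cong]: "sets \<rho> = sets borel"
    and A[measurable]: "A \<in> sets (borel \<Otimes>\<^sub>M borel)" and [measurable]: "w \<in> borel_measurable borel"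
  shows "(\<integral>\<^sup>+u. w u * emeasure \<rho> (Pair u -` A) \<partial>lborel) =
         (\<integral>\<^sup>+x. (\<integral>\<^sup>+u. w u * indicator A (u, x) \<partial>lborel) \<partial>\<rho>)"
proof -
  interpret prob_space \<rho> by fact
  interpret pair_sigma_finite lborel \<rho> ..
  have "(\<integral>\<^sup>+u. w u * emeasure \<rho> (Pair u -` A) \<partial>lborel) =
        (\<integral>\<^sup>+u. (\<integral>\<^sup>+x. w u * indicator A (u, x) \<partial>\<rho>) \<partial>lborel)"
  proof (rule nn_integral_cong)
    fix u
    have [measurable]: "Pair u -` A \<in> sets borel"
      using sets_Pair1[OF A] by simp
    have "(\<integral>\<^sup>+x. w u * indicator A (u, x) \<partial>\<rho>) = (\<integral>\<^sup>+x. w u * indicator (Pair u -` A) x \<partial>\<rho>)"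
      by (simp add: indicator_def)
    also have "\<dots> = w u * emeasure \<rho> (Pair u -` A)"
      by (simp add: nn_integral_cmult_indicator assms(2))
    finally show "w u * emeasure \<rho> (Pair u -` A) = (\<integral>\<^sup>+x. w u * indicator A (u, x) \<partial>\<rho>)" ..
  qed
  also have "\<dots> = (\<integral>\<^sup>+x. (\<integral>\<^sup>+u. w u * indicator A (u, x) \<partial>lborel) \<partial>\<rho>)"
    by (rule Fubini'[symmetric]) measurable
  finally show ?thesis .
qed

lemma nn_integral_ident_Icc:
  fixes x :: real
  shows "(\<integral>\<^sup>+u. ennreal u * indicator {0..x} u \<partial>lborel) = ennreal ((max 0 x)\<^sup>2 / 2)"
proof (cases "0 \<le> x")
  case True
  have "(\<integral>\<^sup>+u. ennreal u * indicator {0..x} u \<partial>lborel) = ennreal (x\<^sup>2 / 2 - 0\<^sup>2 / 2)"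
    by (rule nn_integral_FTC_Icc) (use True in \<open>auto intro!: derivative_eq_intros\<close>)
  with True show ?thesis by simp
qed (simp add: max_def)

text \<open>Tonelli on the wedge \<open>A\<close> of pairs with 0 \<le> u \<le> x: for u \<ge> 0 its
  section at \<open>u\<close> is the tail \<open>{u..}\<close>, and its section at \<open>x\<close>
  is \<open>{0..x}\<close>, over which \<open>u\<close> integrates to half the square of the
  positive part of \<open>x\<close>. For negative \<open>u\<close> the weight
  \<open>ennreal u\<close> vanishes.\<close>

lemma nn_integral_tail_closed:
  fixes \<rho> :: "real measure"
  assumes "prob_space \<rho>" "sets \<rho> = sets borel"
  shows "(\<integral>\<^sup>+u\<in>{0..}. emeasure \<rho> {u..} * ennreal u \<partial>lborel) =
         (\<integral>\<^sup>+x. ennreal ((max 0 x)\<^sup>2 / 2) \<partial>\<rho>)"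
proof -
  define A where "A = {p \<in> space (borel \<Otimes>\<^sub>M borel) :: (real \<times> real) set. 0 \<le> fst p \<and> fst p \<le> snd p}"
  have [measurable]: "A \<in> sets (borel \<Otimes>\<^sub>M borel)"
    unfolding A_def by measurable
  have "(\<integral>\<^sup>+u\<in>{0..}. emeasure \<rho> {u..} * ennreal u \<partial>lborel) =
        (\<integral>\<^sup>+u. ennreal u * emeasure \<rho> (Pair u -` A) \<partial>lborel)"
  proof (rule nn_integral_cong)
    fix u :: real
    show "emeasure \<rho> {u..} * ennreal u * indicator {0..} u = ennreal u * emeasure \<rho> (Pair u -` A)"
    proof (cases "0 \<le> u")
      case True
      then have "Pair u -` A = {u..}" by (auto simp: A_def space_pair_measure)
      with True show ?thesis by (simp add: mult.commute)
    qed (simp add: ennreal_neg)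
  qed
  also have "\<dots> = (\<integral>\<^sup>+x. (\<integral>\<^sup>+u. ennreal u * indicator A (u, x) \<partial>lborel) \<partial>\<rho>)"
    by (rule nn_integral_emeasure_sections) (use assms in auto)
  also have "\<dots> = (\<integral>\<^sup>+x. (\<integral>\<^sup>+u. ennreal u * indicator {0..x} u \<partial>lborel) \<partial>\<rho>)"
    by (simp add: A_def space_pair_measure indicator_def)
  finally show ?thesis by (simp add: nn_integral_ident_Icc)
qed

lemma nn_integral_tail_open:
  fixes \<rho> :: "real measure"
  assumes "prob_space \<rho>" "sets \<rho> = sets borel"
  shows "(\<integral>\<^sup>+u\<in>{0..}. emeasure \<rho> {u<..} * ennreal u \<partial>lborel) =
         (\<integral>\<^sup>+x. ennreal ((max 0 x)\<^sup>2 / 2) \<partial>\<rho>)"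
proof -
  define A where "A = {p \<in> space (borel \<Otimes>\<^sub>M borel) :: (real \<times> real) set. 0 \<le> fst p \<and> fst p < snd p}"
  have [measurable]: "A \<in> sets (borel \<Otimes>\<^sub>M borel)"
    unfolding A_def by measurable
  have "(\<integral>\<^sup>+u\<in>{0..}. emeasure \<rho> {u<..} * ennreal u \<partial>lborel) =
        (\<integral>\<^sup>+u. ennreal u * emeasure \<rho> (Pair u -` A) \<partial>lborel)"
  proof (rule nn_integral_cong)
    fix u :: real
    show "emeasure \<rho> {u<..} * ennreal u * indicator {0..} u = ennreal u * emeasure \<rho> (Pair u -` A)"
    proof (cases "0 \<le> u")
      case True
      then have "Pair u -` A = {u<..}" by (auto simp: A_def space_pair_measure)
      with True show ?thesis by (simp add: mult.commute)
    qed (simp add: ennreal_neg)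
  qed
  also have "\<dots> = (\<integral>\<^sup>+x. (\<integral>\<^sup>+u. ennreal u * indicator A (u, x) \<partial>lborel) \<partial>\<rho>)"
    by (rule nn_integral_emeasure_sections) (use assms in auto)
  also have "\<dots> = (\<integral>\<^sup>+x. (\<integral>\<^sup>+u. ennreal u * indicator {0..x} u \<partial>lborel) \<partial>\<rho>)"
  proof (rule nn_integral_cong, rule nn_integral_cong_AE)
    fix x :: real
    \<comment> \<open>The section at \<open>x\<close> is now \<open>{0..<x}\<close>, which differs
      from \<open>{0..x}\<close> at most in the Lebesgue-null point u = x. Open and closed tails
      therefore have the same integral even if \<open>\<rho>\<close> has atoms.\<close>
    show "AE u in lborel. ennreal u * indicator A (u, x) = ennreal u * indicator {0..x} u"
      using AE_lborel_singleton[of x] by eventually_elim (auto simp: A_def space_pair_measure indicator_def)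
  qed
  finally show ?thesis by (simp add: nn_integral_ident_Icc)
qed

text \<open>Tonelli on the region between 0 and the graph of \<open>g\<close>: its section at t
  \<ge> 0 is a superlevel set, its section at \<open>x\<close> is an interval of length
  \<open>g x\<close>.\<close>

lemma nn_integral_layer_cake:
  fixes \<rho> :: "real measure" and g :: "real \<Rightarrow> real"
  assumes "prob_space \<rho>" "sets \<rho> = sets borel" and [measurable]: "g \<in> borel_measurable borel"
    and nonneg: "\<And>x. 0 \<le> g x"
  shows "(\<integral>\<^sup>+x. ennreal (g x) \<partial>\<rho>) = (\<integral>\<^sup>+t\<in>{0..}. emeasure \<rho> {x. t < g x} \<partial>lborel)"
proof -
  define A where "A = {p \<in> space (borel \<Otimes>\<^sub>M borel) :: (real \<times> real) set. 0 \<le> fst p \<and> fst p < g (snd p)}"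
  have [measurable]: "A \<in> sets (borel \<Otimes>\<^sub>M borel)"
    unfolding A_def by measurable
  have "(\<integral>\<^sup>+t\<in>{0..}. emeasure \<rho> {x. t < g x} \<partial>lborel) =
        (\<integral>\<^sup>+t. 1 * emeasure \<rho> (Pair t -` A) \<partial>lborel)"
    by (intro nn_integral_cong) (auto simp: A_def space_pair_measure indicator_def)
  also have "\<dots> = (\<integral>\<^sup>+x. (\<integral>\<^sup>+t. 1 * indicator A (t, x) \<partial>lborel) \<partial>\<rho>)"
    by (rule nn_integral_emeasure_sections) (use assms in auto)
  also have "\<dots> = (\<integral>\<^sup>+x. (\<integral>\<^sup>+t. indicator {0..<g x} t \<partial>lborel) \<partial>\<rho>)"
    by (simp add: A_def space_pair_measure indicator_def)
  finally show ?thesis by (simp add: nonneg)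
qed

section \<open>Stochastic order, upper sets and tails\<close>

text \<open>An upper set of reals is empty, the whole line, or a half-line, open or closed, starting
  at its infimum. Open half-lines are the hypothesis; the closed ones need a limit.\<close>

lemma emeasure_upset_mono:
  fixes \<mu> \<nu> :: "real measure"
  assumes \<mu>: "prob_space \<mu>" "sets \<mu> = sets borel" and \<nu>: "prob_space \<nu>" "sets \<nu> = sets borel"
    and tails: "\<And>u. emeasure \<mu> {u<..} \<le> emeasure \<nu> {u<..}"
    and up: "\<And>x y. x \<in> S \<Longrightarrow> x \<le> y \<Longrightarrow> y \<in> S"
  shows "emeasure \<mu> S \<le> emeasure \<nu> S"
proof -
  interpret \<mu>: prob_space \<mu> by fact
  interpret \<nu>: prob_space \<nu> by fact
  have Icc: "emeasure \<mu> {c..} \<le> emeasure \<nu> {c..}" for c :: real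
  proof -
    \<comment> \<open>Open half-lines starting slightly to the left of \<open>c\<close> decrease to
      \<open>{c..}\<close>. Both measures are finite, so continuity from above transfers the
      inequality.\<close>
    let ?A = "\<lambda>n. {c - inverse (real (Suc n))<..}"
    have Int: "{c..} = (\<Inter>n. ?A n)"
    proof (intro equalityI subsetI)
      fix x assume x: "x \<in> (\<Inter>n. ?A n)"
      show "x \<in> {c..}"
      proof (rule ccontr)
        assume "x \<notin> {c..}"
        then obtain n where "inverse (real (Suc n)) < c - x"
          using reals_Archimedean[of "c - x"] by auto
        moreover have "c - inverse (real (Suc n)) < x"
          using x by (auto simp del: of_nat_Suc)
        ultimately show False by linarith
      qed
    next
      fix x assume "x \<in> {c..}"
      then show "x \<in> (\<Inter>n. ?A n)"
        by (auto intro: less_le_trans[of _ c])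
    qed
    have dec: "decseq ?A"
      by (auto simp: decseq_def intro!: le_less_trans[OF diff_left_mono] le_imp_inverse_le)
    have "emeasure \<mu> {c..} = (INF n. emeasure \<mu> (?A n))"
      unfolding Int using dec by (intro INF_emeasure_decseq[symmetric]) (auto simp: \<mu>)
    moreover have "emeasure \<nu> {c..} = (INF n. emeasure \<nu> (?A n))"
      unfolding Int using dec by (intro INF_emeasure_decseq[symmetric]) (auto simp: \<nu>)
    ultimately show ?thesis by (auto intro!: INF_mono' tails)
  qed
  show ?thesis
  proof (cases "S = {}")
    case nonempty: False
    show ?thesis
    proof (cases "bdd_below S")
      case True
      define c where "c = Inf S"
      have "S = {c..} \<or> S = {c<..}"
      proof (cases "c \<in> S")
        case Inf: True
        have "S = {c..}"
        proof (intro equalityI subsetI)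
          show "x \<in> {c..}" if "x \<in> S" for x
            using cInf_lower[OF that True, folded c_def] by simp
          show "x \<in> S" if "x \<in> {c..}" for x
            using up[OF Inf] that by simp
        qed
        then show ?thesis ..
      next
        case Inf: False
        have "S = {c<..}"
        proof (intro equalityI subsetI)
          show "x \<in> {c<..}" if "x \<in> S" for x
            using cInf_lower[OF that True, folded c_def] Inf that by (cases "x = c") auto
          show "x \<in> S" if x: "x \<in> {c<..}" for x
          proof -
            obtain y where "y \<in> S" "y < x"
              using cInf_lessD[OF nonempty, folded c_def, of x] x by auto
            then show ?thesis using up[of y x] by simp
          qed
        qed
        then show ?thesis ..
      qed
      then show ?thesis using Icc[of c] tails[of c] by auto
    next
      case False
      have "x \<in> S" for x
      proof -
        obtain y where "y \<in> S" "\<not> x \<le> y" using False unfolding bdd_below_def by blast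
        then show ?thesis using up[of y x] by simp
      qed
      then have "S = UNIV" by blast
      moreover have "space \<mu> = UNIV" "space \<nu> = UNIV"
        using \<mu>(2)[THEN sets_eq_imp_space_eq] \<nu>(2)[THEN sets_eq_imp_space_eq] by simp_all
      ultimately show ?thesis using \<mu>.emeasure_space_1 \<nu>.emeasure_space_1 by simp
    qed
  qed simp
qed

text \<open>The indicator of an upper set is itself a bounded non-decreasing test function.\<close>

lemma st_le_upsetD:
  assumes le: "\<mu> \<le>st \<nu>" and \<mu>: "prob_space \<mu>" "sets \<mu> = sets borel"
    and \<nu>: "prob_space \<nu>" "sets \<nu> = sets borel"
    and S: "S \<in> sets borel" and up: "\<And>x y. x \<in> S \<Longrightarrow> x \<le> y \<Longrightarrow> y \<in> S"
  shows "emeasure \<mu> S \<le> emeasure \<nu> S"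
proof -
  interpret \<mu>: prob_space \<mu> by fact
  interpret \<nu>: prob_space \<nu> by fact
  have "mono (indicator S :: real \<Rightarrow> real)"
    by (auto simp: mono_def indicator_def intro: up)
  moreover have "bounded (range (indicator S :: real \<Rightarrow> real))"
    by (rule boundedI[of _ 1]) (auto simp: indicator_def)
  ultimately have "(\<integral>x. indicator S x \<partial>\<mu>) \<le> (\<integral>x. indicator S x \<partial>\<nu> :: real)"
    using le unfolding st_le_def by blast
  moreover have "space \<mu> = UNIV" "space \<nu> = UNIV"
    using \<mu>(2)[THEN sets_eq_imp_space_eq] \<nu>(2)[THEN sets_eq_imp_space_eq] by simp_all
  ultimately have "measure \<mu> S \<le> measure \<nu> S" by simp
  then show ?thesis by (simp add: \<mu>.emeasure_eq_measure \<nu>.emeasure_eq_measure)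
qed

text \<open>By the layer-cake formula an expectation is an integral of measures of superlevel sets,
  and the superlevel sets of a non-decreasing function are upper sets.\<close>

lemma st_leI:
  assumes \<mu>: "prob_space \<mu>" "sets \<mu> = sets borel"
    and \<nu>: "prob_space \<nu>" "sets \<nu> = sets borel"
    and tails: "\<And>u. emeasure \<mu> {u<..} \<le> emeasure \<nu> {u<..}"
  shows "\<mu> \<le>st \<nu>"
  unfolding st_le_def
proof (intro allI impI)
  fix f :: "real \<Rightarrow> real" assume f: "mono f" "bounded (range f)"
  interpret \<mu>: prob_space \<mu> by fact
  interpret \<nu>: prob_space \<nu> by fact
  obtain B where B: "\<And>x. \<bar>f x\<bar> \<le> B"
    using f(2) by (auto simp: bounded_iff)
  \<comment> \<open>The shift by the bound \<open>B\<close> gives the non-negativity that the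
    layer-cake formula asks for. It adds \<open>B\<close> to both integrals, since both measures
    have mass 1, and so cancels at the end.\<close>
  define g where "g x = f x + B" for x
  have g0: "0 \<le> g x" for x using B[of x] by (simp add: g_def)
  have [measurable]: "f \<in> borel_measurable borel" using f(1) by (rule borel_measurable_mono)
  then have g[measurable]: "g \<in> borel_measurable borel" unfolding g_def by measurable
  have int: "integrable \<mu> f" "integrable \<nu> f"
    by (rule \<mu>.integrable_const_bound[of _ B] \<nu>.integrable_const_bound[of _ B],
        use B \<mu>(2) \<nu>(2) in \<open>auto cong: measurable_cong_sets\<close>)+
  have "(\<integral>\<^sup>+x. ennreal (g x) \<partial>\<mu>) = (\<integral>\<^sup>+t\<in>{0..}. emeasure \<mu> {x. t < g x} \<partial>lborel)"
    by (rule nn_integral_layer_cake) (use \<mu> g g0 in auto)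
  also have "\<dots> \<le> (\<integral>\<^sup>+t\<in>{0..}. emeasure \<nu> {x. t < g x} \<partial>lborel)"
  proof (intro nn_integral_mono mult_right_mono emeasure_upset_mono[OF \<mu> \<nu> tails])
    fix t x y assume "x \<in> {x. t < g x}" "x \<le> y"
    then show "y \<in> {x. t < g x}" using monoD[OF f(1), of x y] by (simp add: g_def)
  qed simp
  also have "\<dots> = (\<integral>\<^sup>+x. ennreal (g x) \<partial>\<nu>)"
    by (rule nn_integral_layer_cake[symmetric]) (use \<nu> g g0 in auto)
  finally have "ennreal (\<integral>x. g x \<partial>\<mu>) \<le> ennreal (\<integral>x. g x \<partial>\<nu>)"
    using int g0 by (simp add: nn_integral_eq_integral g_def)
  then have "(\<integral>x. g x \<partial>\<mu>) \<le> (\<integral>x. g x \<partial>\<nu>)"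
    using g0 by (simp add: integral_nonneg_AE)
  then show "(\<integral>x. f x \<partial>\<mu>) \<le> (\<integral>x. f x \<partial>\<nu>)"
    using int by (simp add: g_def \<mu>.prob_space \<nu>.prob_space)
qed

section \<open>Upper bounds and integrated tails\<close>

text \<open>The tails of an upper bound dominate the supremum pointwise, and their integral is at
  most its second moment.\<close>

lemma tails_finite_of_st_bdd_above:
  assumes M: "M \<subseteq> P2" and bdd: "st_bdd_above M"
  shows "(\<integral>\<^sup>+u\<in>{0..}. (SUP \<mu>\<in>M. emeasure \<mu> {u..}) * ennreal u \<partial>lborel) < \<infinity>"
proof -
  obtain \<rho> where \<rho>: "\<rho> \<in> P2" and le: "\<And>\<mu>. \<mu> \<in> M \<Longrightarrow> \<mu> \<le>st \<rho>"
    using bdd unfolding st_bdd_above_def by blast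
  have \<rho>': "prob_space \<rho>" "sets \<rho> = sets borel" "integrable \<rho> (\<lambda>x. x\<^sup>2)"
    using \<rho> by (auto simp: P2_def)
  have "(SUP \<mu>\<in>M. emeasure \<mu> {u..}) \<le> emeasure \<rho> {u..}" for u
    using M \<rho>' le by (intro SUP_least st_le_upsetD) (auto simp: P2_def)
  then have "(\<integral>\<^sup>+u\<in>{0..}. (SUP \<mu>\<in>M. emeasure \<mu> {u..}) * ennreal u \<partial>lborel) \<le>
        (\<integral>\<^sup>+u\<in>{0..}. emeasure \<rho> {u..} * ennreal u \<partial>lborel)"
    by (intro nn_integral_mono mult_right_mono) auto
  also have "\<dots> = (\<integral>\<^sup>+x. ennreal ((max 0 x)\<^sup>2 / 2) \<partial>\<rho>)"
    by (rule nn_integral_tail_closed) (use \<rho>' in auto)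
  also have "\<dots> \<le> (\<integral>\<^sup>+x. ennreal (x\<^sup>2) \<partial>\<rho>)"
    by (intro nn_integral_mono ennreal_leI) (auto simp: max_def)
  also have "\<dots> < \<infinity>"
    using \<rho>'(3) by (subst nn_integral_eq_integral) auto
  finally show ?thesis .
qed

text \<open>The bound constructed here is the least upper bound of \<open>M\<close> together with
  the point mass at 0. Its tail function is 1 on the negative half-line and the supremum
  \<open>G\<close> from 0 on.\<close>

lemma st_bdd_above_of_tails_finite:
  assumes M: "M \<subseteq> P2"
    and fin: "(\<integral>\<^sup>+u\<in>{0..}. (SUP \<mu>\<in>M. emeasure \<mu> {u<..}) * ennreal u \<partial>lborel) < \<infinity>"
  shows "st_bdd_above M"
proof -
  define G where "G u = (SUP \<mu>\<in>M. emeasure \<mu> {u<..})" for u :: real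
  have prob: "prob_space \<mu>" "sets \<mu> = sets borel" if "\<mu> \<in> M" for \<mu>
    using M that by (auto simp: P2_def)
  have G1: "G u \<le> 1" for u
    unfolding G_def using prob(1) by (intro SUP_least) (simp add: prob_space.measure_le_1)
  have G_fin: "G u < top" for u using G1[of u] by (simp add: le_less_trans)
  have G_anti: "G v \<le> G u" if "u \<le> v" for u v
    unfolding G_def using that by (intro SUP_subset_mono emeasure_mono) (auto simp: prob)
  \<comment> \<open>Right-continuity of \<open>G\<close>: each \<open>\<mu>\<close> is continuous
    from below along these increasing open half-lines, and the two suprema commute.\<close>
  have G_SUP: "(SUP n. G (u + inverse (real (Suc n)))) = G u" for u
  proof -
    let ?A = "\<lambda>n. {u + inverse (real (Suc n))<..}"
    have "(\<Union>n. ?A n) = {u<..}"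
    proof (intro equalityI subsetI)
      fix x assume "x \<in> (\<Union>n. ?A n)"
      then obtain n where "u + inverse (real (Suc n)) < x" by auto
      moreover have "0 < inverse (real (Suc n))" by simp
      ultimately show "x \<in> {u<..}" unfolding greaterThan_iff by linarith
    next
      fix x assume "x \<in> {u<..}"
      then obtain n where "inverse (real (Suc n)) < x - u"
        using reals_Archimedean[of "x - u"] by auto
      then show "x \<in> (\<Union>n. ?A n)" by (auto intro!: exI[of _ n])
    qed
    moreover have "incseq ?A"
      by (auto simp: incseq_def intro!: le_less_trans[OF add_left_mono] le_imp_inverse_le)
    ultimately have "(SUP n. emeasure \<mu> (?A n)) = emeasure \<mu> {u<..}" if "\<mu> \<in> M" for \<mu>
      using prob[OF that] by (subst SUP_emeasure_incseq) auto
    then show ?thesis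
      unfolding G_def by (subst SUP_commute) (simp cong: SUP_cong)
  qed
  define H where "H u = enn2real (G u)" for u
  have H: "ennreal (H u) = G u" for u using G_fin by (simp add: H_def)
  have H0: "0 \<le> H u" for u by (simp add: H_def)
  have H1: "H u \<le> 1" for u using G1[of u] by (simp flip: H)
  have H_anti: "H v \<le> H u" if "u \<le> v" for u v
    using G_anti[OF that] by (simp flip: H add: H0)

  \<comment> \<open>The distribution function of the bound. Mass missing from the tail at 0, namely
    \<open>1 - H 0\<close>, becomes an atom at 0.\<close>
  define F where "F u = (if u < 0 then 0 else 1 - H u)" for u
  have F_mono: "F x \<le> F y" if "x \<le> y" for x y
    using that H1[of y] H_anti[of x y] by (auto simp: F_def)
  have F_right: "continuous (at_right a) F" for a
    proof (subst continuous_at_right_real_increasing, fact F_mono, intro allI impI)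
    fix e :: real assume e: "0 < e"
    show "\<exists>d>0. F (a + d) - F a < e"
    proof (cases "a < 0")
      case True
      \<comment> \<open>With this step \<open>a + d\<close> is still negative, so \<open>F\<close>
        is 0 at both points.\<close>
      then show ?thesis using e by (intro exI[of _ "- a / 2"]) (auto simp: F_def)
    next
      case False
      \<comment> \<open>Otherwise all values of \<open>G\<close> at points
        \<open>a + 1/(n+1)\<close> would stay below \<open>H a - e\<close>, hence so would their
        supremum \<open>G a\<close>.\<close>
      have "\<exists>n. H a < H (a + inverse (real (Suc n))) + e"
      proof (rule ccontr)
        assume "\<not> ?thesis"
        then have le: "H (a + inverse (real (Suc n))) \<le> H a - e" for n
          by (auto simp: not_less algebra_simps)
        \<comment> \<open>Since \<open>ennreal\<close> sends negative reals to 0, the contradiction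
          in the reals needs this sign.\<close>
        have "0 \<le> H a - e" using le[of 0] H0 order_trans by blast
        have "G a \<le> ennreal (H a - e)"
          unfolding G_SUP[of a, symmetric] using le by (intro SUP_least) (simp flip: H add: ennreal_leI)
        then show False using \<open>0 \<le> H a - e\<close> e by (simp flip: H)
      qed
      then obtain n where "H a < H (a + inverse (real (Suc n))) + e" ..
      moreover have "0 < inverse (real (Suc n))" by simp
      ultimately obtain d where "0 < d" "H a < H (a + d) + e" by blast
      then show ?thesis using False by (intro exI[of _ d]) (simp add: F_def)
    qed
  qed
  have F_bot: "(F \<longlongrightarrow> 0) at_bot"
    by (rule tendsto_eventually) (auto simp: F_def eventually_at_bot_dense intro!: exI[of _ 0])
  define C where "C = enn2real (\<integral>\<^sup>+u\<in>{0..}. G u * ennreal u \<partial>lborel)"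
  have C: "ennreal C = (\<integral>\<^sup>+u\<in>{0..}. G u * ennreal u \<partial>lborel)"
    using fin by (simp add: C_def G_def)
  have C0: "0 \<le> C" by (simp add: C_def)
  \<comment> \<open>A Markov-type bound: \<open>G\<close> is at least \<open>G u\<close> on
    \<open>{0..u}\<close>, where the weight integrates to half the square of \<open>u\<close>. Thus
    \<open>H\<close> decays at least like the inverse square, which forces the limit 0.\<close>
  have H_decay: "H u * (u\<^sup>2 / 2) \<le> C" if "0 < u" for u
  proof -
    have "ennreal (H u * (u\<^sup>2 / 2)) = G u * ennreal (u\<^sup>2 / 2)"
      using ennreal_mult'[OF H0[of u]] by (simp only: H)
    also have "\<dots> = G u * (\<integral>\<^sup>+s. ennreal s * indicator {0..u} s \<partial>lborel)"
      using that by (simp add: nn_integral_ident_Icc)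
    also have "\<dots> = (\<integral>\<^sup>+s. G u * (ennreal s * indicator {0..u} s) \<partial>lborel)"
      by (rule nn_integral_cmult[symmetric]) measurable
    also have "\<dots> \<le> (\<integral>\<^sup>+s\<in>{0..}. G s * ennreal s \<partial>lborel)"
      by (intro nn_integral_mono) (auto simp: indicator_def intro!: mult_right_mono G_anti)
    finally show ?thesis using C0 by (simp flip: C)
  qed
  have "(H \<longlongrightarrow> 0) at_top"
  proof (rule tendsto_sandwich)
    show "\<forall>\<^sub>F u in at_top. 0 \<le> H u" using H0 by simp
    show "\<forall>\<^sub>F u in at_top. H u \<le> 2 * C / u\<^sup>2"
      using eventually_gt_at_top[of 0] by eventually_elim (use H_decay in \<open>auto simp: field_simps\<close>)
    show "((\<lambda>u. 2 * C / u\<^sup>2) \<longlongrightarrow> 0) at_top"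
      by (intro tendsto_divide_0[OF tendsto_const] filterlim_at_top_imp_at_infinity
            filterlim_pow_at_top filterlim_ident) auto
  qed simp
  then have "((\<lambda>u. 1 - H u) \<longlongrightarrow> 1 - 0) at_top" by (intro tendsto_intros)
  moreover have "\<forall>\<^sub>F u in at_top. 1 - H u = F u"
    using eventually_ge_at_top[of 0] by eventually_elim (simp add: F_def)
  ultimately have F_top: "(F \<longlongrightarrow> 1) at_top"
    by (simp add: tendsto_cong)

  define \<rho> where "\<rho> = interval_measure F"
  interpret real_distribution \<rho>
    unfolding \<rho>_def using F_mono F_right F_bot F_top by (rule real_distribution_interval_measure)
  have cdf: "cdf \<rho> = F"
    unfolding \<rho>_def using F_mono F_right F_bot by (rule cdf_interval_measure)
  have tail: "emeasure \<rho> {u<..} = (if u < 0 then 1 else G u)" for u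
  proof -
    have "{u<..} = space \<rho> - {..u}" by auto
    then have "measure \<rho> {u<..} = 1 - F u"
      using prob_compl[of "{..u}"] by (simp add: cdf[symmetric] cdf_def)
    then show ?thesis by (simp add: emeasure_eq_measure F_def H)
  qed
  \<comment> \<open>The left limit of a distribution function at 0 is the mass of the open negative
    half-line, and \<open>F\<close> vanishes there.\<close>
  have "measure \<rho> {..<0} = 0"
  proof (rule tendsto_unique[OF _ cdf_at_left])
    show "(cdf \<rho> \<longlongrightarrow> 0) (at_left 0)"
      by (rule tendsto_eventually)
         (auto simp: cdf F_def eventually_at_left_field intro!: exI[of _ "-1"])
  qed simp
  then have "{..<0} \<in> null_sets \<rho>" by (simp add: null_sets_def emeasure_eq_measure)
  \<comment> \<open>Hence the positive part carries the whole second moment, which the open-tail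
    formula evaluates to \<open>2 * C\<close>.\<close>
  then have pos: "AE x in \<rho>. 0 \<le> x"
    by (rule AE_I') auto
  have "(\<integral>\<^sup>+x. ennreal (x\<^sup>2) \<partial>\<rho>) = (\<integral>\<^sup>+x. 2 * ennreal ((max 0 x)\<^sup>2 / 2) \<partial>\<rho>)"
    by (rule nn_integral_cong_AE, use pos in eventually_elim)
       (simp flip: ennreal_numeral ennreal_mult)
  also have "\<dots> = 2 * (\<integral>\<^sup>+u\<in>{0..}. emeasure \<rho> {u<..} * ennreal u \<partial>lborel)"
    by (subst nn_integral_tail_open) (auto simp: prob_space_axioms intro!: nn_integral_cmult)
  also have "(\<integral>\<^sup>+u\<in>{0..}. emeasure \<rho> {u<..} * ennreal u \<partial>lborel) = ennreal C"
    unfolding C tail by (intro nn_integral_cong) (simp add: indicator_def)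
  finally have "integrable \<rho> (\<lambda>x. x\<^sup>2)"
    by (intro integrableI_bounded) (auto simp: ennreal_mult_less_top)
  then have "\<rho> \<in> P2" by (simp add: P2_def prob_space_axioms)
  moreover have "\<mu> \<le>st \<rho>" if \<mu>: "\<mu> \<in> M" for \<mu>
  proof (rule st_leI)
    fix u
    have "emeasure \<mu> {u<..} \<le> 1"
      using prob[OF \<mu>] by (simp add: prob_space.measure_le_1)
    moreover have "emeasure \<mu> {u<..} \<le> G u"
      unfolding G_def using \<mu> by (rule SUP_upper)
    ultimately show "emeasure \<mu> {u<..} \<le> emeasure \<rho> {u<..}" by (simp add: tail)
  qed (use prob[OF \<mu>] prob_space_axioms in auto)
  ultimately show ?thesis unfolding st_bdd_above_def by blast
qed

section \<open>Reflection at the origin\<close>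

definition reflect :: "real measure \<Rightarrow> real measure" where
  "reflect \<mu> = distr \<mu> borel uminus"

lemma emeasure_reflect:
  assumes "sets \<mu> = sets borel" "S \<in> sets borel"
  shows "emeasure (reflect \<mu>) S = emeasure \<mu> (uminus -` S)"
proof -
  have "space \<mu> = UNIV" using assms(1)[THEN sets_eq_imp_space_eq] by simp
  then show ?thesis
    unfolding reflect_def using assms by (subst emeasure_distr) (auto cong: measurable_cong_sets)
qed

lemma reflect_reflect:
  assumes [measurable_cong]: "sets \<mu> = sets borel"
  shows "reflect (reflect \<mu>) = \<mu>"
proof -
  have "reflect (reflect \<mu>) = distr \<mu> borel (uminus \<circ> uminus)"
    unfolding reflect_def by (rule distr_distr) measurable
  also have "\<dots> = \<mu>" by (simp add: o_def distr_id2 assms)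
  finally show ?thesis .
qed

lemma reflect_P2:
  assumes "\<mu> \<in> P2" shows "reflect \<mu> \<in> P2"
proof -
  have \<mu>: "prob_space \<mu>" "sets \<mu> = sets borel" "integrable \<mu> (\<lambda>x. x\<^sup>2)"
    using assms by (auto simp: P2_def)
  have m: "uminus \<in> measurable \<mu> borel" using \<mu>(2) by (auto cong: measurable_cong_sets)
  show ?thesis
    using \<mu> m prob_space.prob_space_distr[OF \<mu>(1) m]
    by (simp add: P2_def reflect_def integrable_distr_eq)
qed

text \<open>If \<open>f\<close> is bounded and non-decreasing, so is the map from \<open>x\<close>
  to \<open>- f (- x)\<close>. Testing with it and changing variables reverses the
  inequality.\<close>

lemma st_le_reflect:
  assumes le: "\<mu> \<le>st \<nu>" and sets: "sets \<mu> = sets borel" "sets \<nu> = sets borel"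
  shows "reflect \<nu> \<le>st reflect \<mu>"
  unfolding st_le_def
proof (intro allI impI)
  fix f :: "real \<Rightarrow> real" assume f: "mono f" "bounded (range f)"
  have mf: "f \<in> borel_measurable borel" using f(1) by (rule borel_measurable_mono)
  have refl: "(\<integral>x. f x \<partial>reflect \<kappa>) = - (\<integral>x. - f (- x) \<partial>\<kappa>)" if "sets \<kappa> = sets borel" for \<kappa>
    unfolding reflect_def using mf that
    by (subst integral_distr) (auto cong: measurable_cong_sets)
  have "mono (\<lambda>x. - f (- x))" using f(1) by (auto simp: mono_def)
  moreover have "bounded (range (\<lambda>x. - f (- x)))"
    using f(2) by (auto simp: bounded_iff)
  ultimately have "(\<integral>x. - f (- x) \<partial>\<mu>) \<le> (\<integral>x. - f (- x) \<partial>\<nu>)"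
    using le unfolding st_le_def by blast
  then show "(\<integral>x. f x \<partial>reflect \<nu>) \<le> (\<integral>x. f x \<partial>reflect \<mu>)"
    by (simp only: refl sets neg_le_iff_le)
qed

text \<open>\<open>reflect\<close> is an order-reversing involution of \<open>P2\<close>, so the
  reflection of a bound on one side is a bound on the other side for the reflected family.\<close>

lemma st_bdd_below_iff_reflect:
  assumes M: "M \<subseteq> P2"
  shows "st_bdd_below M \<longleftrightarrow> st_bdd_above (reflect ` M)"
proof
  assume "st_bdd_below M"
  then obtain \<rho> where "\<rho> \<in> P2" "\<And>\<mu>. \<mu> \<in> M \<Longrightarrow> \<rho> \<le>st \<mu>"
    unfolding st_bdd_below_def by blast
  moreover from this have "reflect \<mu> \<le>st reflect \<rho>" if "\<mu> \<in> M" for \<mu>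
    using M that by (intro st_le_reflect) (auto simp: P2_def)
  ultimately show "st_bdd_above (reflect ` M)"
    unfolding st_bdd_above_def using reflect_P2 by blast
next
  assume "st_bdd_above (reflect ` M)"
  then obtain \<rho> where \<rho>: "\<rho> \<in> P2" "\<And>\<mu>. \<mu> \<in> M \<Longrightarrow> reflect \<mu> \<le>st \<rho>"
    unfolding st_bdd_above_def by blast
  have "reflect \<rho> \<le>st \<mu>" if "\<mu> \<in> M" for \<mu>
  proof -
    have "sets \<mu> = sets borel" "sets \<rho> = sets borel" using M that \<rho>(1) by (auto simp: P2_def)
    then show ?thesis
      using st_le_reflect[OF \<rho>(2)[OF that]] reflect_reflect[of \<mu>] by (simp add: reflect_def)
  qed
  then show "st_bdd_below M"
    unfolding st_bdd_below_def using \<rho>(1) reflect_P2 by blast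
qed

theorem proposition2p2:
  fixes M :: "real measure set"
  assumes "M \<subseteq> P2"
  shows "(st_bdd_above M \<longleftrightarrow>
           (\<integral>\<^sup>+u\<in>{0..}. (SUP \<mu>\<in>M. emeasure \<mu> {u<..}) * ennreal u \<partial>lborel) < \<infinity>) \<and>
         (st_bdd_below M \<longleftrightarrow>
           (\<integral>\<^sup>+u\<in>{0..}. (SUP \<mu>\<in>M. emeasure \<mu> {..- u}) * ennreal u \<partial>lborel) < \<infinity>)"
proof -
  have open_le_closed: "(\<integral>\<^sup>+u\<in>{0..}. (SUP \<mu>\<in>N. emeasure \<mu> {u<..}) * ennreal u \<partial>lborel) \<le>
      (\<integral>\<^sup>+u\<in>{0..}. (SUP \<mu>\<in>N. emeasure \<mu> {u..}) * ennreal u \<partial>lborel)" if "N \<subseteq> P2" for N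
    using that
    by (intro nn_integral_mono mult_right_mono SUP_subset_mono emeasure_mono) (auto simp: P2_def)
  \<comment> \<open>A cycle of implications: an upper bound makes the closed-tail integral finite,
    this makes the smaller open-tail integral finite, and that yields an upper bound again.\<close>
  have above: "st_bdd_above N \<longleftrightarrow>
      (\<integral>\<^sup>+u\<in>{0..}. (SUP \<mu>\<in>N. emeasure \<mu> {u<..}) * ennreal u \<partial>lborel) < \<infinity>"
    "st_bdd_above N \<longleftrightarrow>
      (\<integral>\<^sup>+u\<in>{0..}. (SUP \<mu>\<in>N. emeasure \<mu> {u..}) * ennreal u \<partial>lborel) < \<infinity>" if "N \<subseteq> P2" for N
    using tails_finite_of_st_bdd_above[OF that] st_bdd_above_of_tails_finite[OF that]
      open_le_closed[OF that] le_less_trans by blast+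
  have "reflect ` M \<subseteq> P2" using assms reflect_P2 by blast
  moreover have "emeasure (reflect \<mu>) {u..} = emeasure \<mu> {..- u}" if "\<mu> \<in> M" for \<mu> and u :: real
  proof -
    \<comment> \<open>The half-lines in (ii) contain their endpoint, so they match the closed-tail
      criterion for the reflected family.\<close>
    have "uminus -` {u..} = {..- u}" by auto
    then show ?thesis using assms that by (subst emeasure_reflect) (auto simp: P2_def)
  qed
  then have "(SUP \<mu>\<in>reflect ` M. emeasure \<mu> {u..}) = (SUP \<mu>\<in>M. emeasure \<mu> {..- u})" for u
    unfolding image_image by (intro SUP_cong) auto
  ultimately show ?thesis
    using above(1)[OF assms] above(2)[of "reflect ` M"] st_bdd_below_iff_reflect[OF assms] by simp
qed

end
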